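(* For a matrix $(\nu_{ij})\in\mathbb C^{r\times r}$ let $$\widehat f_2(y)=\begin{pmatrix}y_1\left(\sum_j\nu_{1j}y_j\right)\\ \vdots\\ y_r\left(\sum_j\nu_{rj}y_j\right)\end{pmatrix},$$ and consider formal vector fields $\widehat f(y)=\widehat f_2(y)+\sum_{k\ge 3}\widehat f_k(y)\in\mathbb C[[y_1,\ldots,y_r]]^r$ ($\widehat f_k$ homogeneous of degree $k$) with quadratic part $\widehat f_2$. Define $\widehat{\mathcal R}\subseteq\mathbb C^{r\times r}$ by the property that $(\nu_{ij})\in\widehat{\mathcal R}$ if and only if the formal centralizer of $\widehat f=\widehat f_2+\text{h.o.t.}$ is trivial, i.e. equal to $\mathbb C\widehat f$, for any choice of higher order terms. Then: (a) $\widehat{\mathcal R}$ has full measure, i.e., its complement in $\mathbb C^{r\times r}$ has measure zero. (b) $\widehat{\mathcal R}$ contains a nonempty open subset of $\mathbb C^{r\times r}$.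
   Context: The formal centralizer of $\widehat f\in\mathbb C[[y_1,\ldots,y_r]]^r$ is the set of all $\widehat g\in\mathbb C[[y_1,\ldots,y_r]]^r$ with $[\widehat g,\widehat f]=0$, where $[g,h](y)=Dh(y)g(y)-Dg(y)h(y)$. *)

theory Defs
  imports "HOL-Analysis.Analysis"
begin

text \<open>
  Formal power series in the variables indexed by a finite type \<open>'v\<close>, given by their coefficients;
  a monomial is represented by its exponent function \<open>'v \<Rightarrow> nat\<close>.
\<close>

typedef ('a, 'v) mfps = "UNIV :: (('v \<Rightarrow> nat) \<Rightarrow> 'a) set"
  morphisms mfps_nth Abs_mfps ..

lemma mfps_nth_Abs [simp]: "mfps_nth (Abs_mfps f) = f"
  by (simp add: Abs_mfps_inverse)

lemma mfps_eq_iff: "F = G \<longleftrightarrow> (\<forall>\<alpha>. mfps_nth F \<alpha> = mfps_nth G \<alpha>)"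
  by (metis ext mfps_nth_inject)

lemma finite_multiindices_le [simp, intro]: "finite {\<beta>. \<beta> \<le> (\<alpha> :: 'v::finite \<Rightarrow> nat)}"
proof -
  have "{\<beta>. \<beta> \<le> \<alpha>} = Pi\<^sub>E UNIV (\<lambda>i. {..\<alpha> i})"
    by (auto simp: le_fun_def PiE_def extensional_def)
  then show ?thesis
    by (simp add: finite_PiE)
qed

text \<open>The product is the Cauchy product; \<open>\<le>\<close> and \<open>-\<close> on exponents are pointwise.\<close>

instantiation mfps :: (comm_ring_1, finite) comm_ring_1
begin

definition "0 = Abs_mfps (\<lambda>_. 0)"
definition "1 = Abs_mfps (\<lambda>\<alpha>. if \<alpha> = (\<lambda>_. 0) then 1 else 0)"
definition "F + G = Abs_mfps (\<lambda>\<alpha>. mfps_nth F \<alpha> + mfps_nth G \<alpha>)"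
definition "F - G = Abs_mfps (\<lambda>\<alpha>. mfps_nth F \<alpha> - mfps_nth G \<alpha>)"
definition "- F = Abs_mfps (\<lambda>\<alpha>. - mfps_nth F \<alpha>)"
definition "F * G = Abs_mfps (\<lambda>\<alpha>. \<Sum>\<beta> | \<beta> \<le> \<alpha>. mfps_nth F \<beta> * mfps_nth G (\<alpha> - \<beta>))"

instance
proof
  fix F G H :: "('a, 'b) mfps"
  have swap: "(\<Sum>\<beta> | \<beta> \<le> \<alpha>. f \<beta> * g (\<alpha> - \<beta>)) = (\<Sum>\<beta> | \<beta> \<le> \<alpha>. g \<beta> * f (\<alpha> - \<beta>))"
    for f g :: "('b \<Rightarrow> nat) \<Rightarrow> 'a" and \<alpha>
    by (rule sum.reindex_bij_witness[where i = "\<lambda>\<beta>. \<alpha> - \<beta>" and j = "\<lambda>\<beta>. \<alpha> - \<beta>"])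
      (auto simp: le_fun_def fun_eq_iff mult.commute fun_diff_def)
  have assoc: "(\<Sum>\<beta> | \<beta> \<le> \<alpha>. (\<Sum>\<gamma> | \<gamma> \<le> \<beta>. f \<gamma> * g (\<beta> - \<gamma>)) * h (\<alpha> - \<beta>)) =
      (\<Sum>\<gamma> | \<gamma> \<le> \<alpha>. f \<gamma> * (\<Sum>\<delta> | \<delta> \<le> \<alpha> - \<gamma>. g \<delta> * h (\<alpha> - \<gamma> - \<delta>)))"
    for f g h :: "('b \<Rightarrow> nat) \<Rightarrow> 'a" and \<alpha>
    unfolding sum_distrib_left sum_distrib_right
    apply (subst sum.Sigma, simp, simp)
    apply (subst sum.Sigma, simp, simp)
    apply (rule sum.reindex_bij_witness[where
          i = "\<lambda>(\<gamma>, \<delta>). (\<lambda>i. \<gamma> i + \<delta> i, \<gamma>)" and j = "\<lambda>(\<beta>, \<gamma>). (\<gamma>, \<beta> - \<gamma>)"])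
        apply (auto simp: le_fun_def fun_eq_iff fun_diff_def mult.assoc)
       apply (metis le_trans)
      apply (metis diff_le_mono)
     apply (metis le_diff_conv2 add.commute)
    done
  have unit: "(\<Sum>\<beta> | \<beta> \<le> \<alpha>. (if \<beta> = (\<lambda>_. 0) then 1 else 0) * f (\<alpha> - \<beta>)) = f \<alpha>"
    for f :: "('b \<Rightarrow> nat) \<Rightarrow> 'a" and \<alpha>
  proof -
    have "(\<Sum>\<beta> | \<beta> \<le> \<alpha>. (if \<beta> = (\<lambda>_. 0) then 1 else 0) * f (\<alpha> - \<beta>)) =
        (\<Sum>\<beta> | \<beta> \<le> \<alpha>. if \<beta> = (\<lambda>_. 0) then f (\<alpha> - \<beta>) else 0)"
      by (rule sum.cong) auto
    also have "\<dots> = f (\<alpha> - (\<lambda>_. 0))"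
      by (subst sum.delta[OF finite_multiindices_le]) (simp add: le_fun_def)
    also have "\<alpha> - (\<lambda>_. 0) = \<alpha>"
      by (simp add: fun_diff_def)
    finally show ?thesis .
  qed
  show "F * G * H = F * (G * H)"
    by (simp add: times_mfps_def mfps_eq_iff assoc)
  show "F * G = G * F"
    using swap by (simp add: times_mfps_def mfps_eq_iff)
  show "1 * F = F"
    by (simp add: times_mfps_def one_mfps_def mfps_eq_iff unit)
  show "F + G + H = F + (G + H)" "F + G = G + F" "0 + F = F" "- F + F = 0" "F - G = F + - G"
    by (simp_all add: plus_mfps_def zero_mfps_def uminus_mfps_def minus_mfps_def mfps_eq_iff
        add.assoc add.commute)
  show "(F + G) * H = F * H + G * H"
    by (simp add: times_mfps_def plus_mfps_def mfps_eq_iff sum.distrib distrib_right)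
  show "(0 :: ('a, 'b) mfps) \<noteq> 1"
    by (auto simp: zero_mfps_def one_mfps_def mfps_eq_iff)
qed

end

definition mfps_const :: "'a \<Rightarrow> ('a :: comm_ring_1, 'v :: finite) mfps" where
  "mfps_const c = Abs_mfps (\<lambda>\<alpha>. if \<alpha> = (\<lambda>_. 0) then c else 0)"

definition mfps_var :: "'v \<Rightarrow> ('a :: comm_ring_1, 'v :: finite) mfps" where
  "mfps_var i = Abs_mfps (\<lambda>\<alpha>. if \<alpha> = (\<lambda>_. 0)(i := 1) then 1 else 0)"

definition mfps_deriv :: "'v \<Rightarrow> ('a :: comm_ring_1, 'v :: finite) mfps \<Rightarrow> ('a, 'v) mfps" where
  "mfps_deriv j F = Abs_mfps (\<lambda>\<alpha>. of_nat (Suc (\<alpha> j)) * mfps_nth F (\<alpha>(j := Suc (\<alpha> j))))"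

type_synonym 'r formal_vf = "(complex, 'r) mfps ^ 'r"

definition jacobian :: "'r::finite formal_vf \<Rightarrow> (complex, 'r) mfps ^ 'r ^ 'r" where
  "jacobian F = (\<chi> i j. mfps_deriv j (F $ i))"

definition lie_bracket :: "'r::finite formal_vf \<Rightarrow> 'r formal_vf \<Rightarrow> 'r formal_vf" where
  "lie_bracket G H = jacobian H *v G - jacobian G *v H"

definition formal_centralizer :: "'r::finite formal_vf \<Rightarrow> 'r formal_vf set" where
  "formal_centralizer F = {G. lie_bracket G F = 0}"

definition homogeneous_part :: "nat \<Rightarrow> 'r::finite formal_vf \<Rightarrow> 'r formal_vf" where
  "homogeneous_part k F =
    (\<chi> i. Abs_mfps (\<lambda>\<alpha>. if (\<Sum>j\<in>UNIV. \<alpha> j) = k then mfps_nth (F $ i) \<alpha> else 0))"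

definition quadratic_vf :: "complex ^ 'r ^ 'r \<Rightarrow> 'r::finite formal_vf" where
  "quadratic_vf \<nu> = (\<chi> i. mfps_var i * (\<Sum>j\<in>UNIV. mfps_const (\<nu> $ i $ j) * mfps_var j))"

text \<open>\<open>F\<close> has the form \<open>quadratic_vf \<nu> + F\<^sub>3 + F\<^sub>4 + \<dots>\<close> with \<open>F\<^sub>k\<close> homogeneous of degree \<open>k\<close>.\<close>

definition starts_with_quadratic :: "complex ^ 'r ^ 'r \<Rightarrow> 'r::finite formal_vf \<Rightarrow> bool" where
  "starts_with_quadratic \<nu> F \<longleftrightarrow>
    homogeneous_part 0 F = 0 \<and> homogeneous_part 1 F = 0 \<and> homogeneous_part 2 F = quadratic_vf \<nu>"

text \<open>\<open>range (\<lambda>c. mfps_const c *s F)\<close> is the complex line spanned by \<open>F\<close>.\<close>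

definition R_hat :: "(complex ^ 'r ^ 'r::finite) set" where
  "R_hat = {\<nu>. \<forall>F. starts_with_quadratic \<nu> F \<longrightarrow>
      formal_centralizer F = range (\<lambda>c. mfps_const c *s F)}"

end

theory Submission
  imports Defs
begin

text \<open>
  If \<open>[g, f] = 0\<close>, then the lowest homogeneous part of \<open>g\<close> commutes with the quadratic part
  \<open>\<Sum>\<^sub>p y\<^sub>p D\<^sub>p\<close> of \<open>f\<close>, where \<open>D\<^sub>p\<close> is the diagonal linear vector field given by the \<open>p\<close>-th column
  of \<open>\<nu>\<close>. Grade vector fields by torus weights: among the weights occurring in this lowest part, one
  with maximal \<open>p\<close>-th entry interacts with \<open>y\<^sub>p D\<^sub>p\<close> only. If the entries of each column satisfy
  no relation from a certain countable family of linear relations with integer coefficients, this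
  forces degree 2 and a nonzero coefficient of \<open>y\<^sub>p\<^sup>2 e\<^sub>p\<close>. Subtracting from \<open>g\<close> the multiple of
  \<open>f\<close> that removes this coefficient leaves \<open>0\<close>. The relations define countably many proper
  hyperplanes, whence full measure; if all entries of \<open>\<nu>\<close> are close to \<open>1\<close>, then all but
  finitely many of them fail automatically, whence the open set.
\<close>

section \<open>Coefficients of formal power series\<close>

lemma mfps_nth_zero [simp]: "mfps_nth 0 \<alpha> = 0"
  by (simp add: zero_mfps_def)

lemma mfps_nth_add [simp]: "mfps_nth (F + G) \<alpha> = mfps_nth F \<alpha> + mfps_nth G \<alpha>"
  by (simp add: plus_mfps_def)

lemma mfps_nth_diff [simp]: "mfps_nth (F - G) \<alpha> = mfps_nth F \<alpha> - mfps_nth G \<alpha>"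
  by (simp add: minus_mfps_def)

lemma mfps_nth_sum: "mfps_nth (sum F A) \<alpha> = (\<Sum>x\<in>A. mfps_nth (F x) \<alpha>)"
  by (induction A rule: infinite_finite_induct) auto

lemma mfps_nth_deriv:
  "mfps_nth (mfps_deriv j F) \<alpha> = of_nat (Suc (\<alpha> j)) * mfps_nth F (\<alpha>(j := Suc (\<alpha> j)))"
  by (simp add: mfps_deriv_def)

lemma mfps_nth_const_mult: "mfps_nth (mfps_const c * F) \<alpha> = c * mfps_nth F \<alpha>"
proof -
  have "mfps_nth (mfps_const c * F) \<alpha> =
      (\<Sum>\<beta> | \<beta> \<le> \<alpha>. if \<beta> = (\<lambda>_. 0) then c * mfps_nth F (\<alpha> - \<beta>) else 0)"
    unfolding times_mfps_def mfps_const_def mfps_nth_Abs by (rule sum.cong) auto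
  also have "\<dots> = c * mfps_nth F (\<alpha> - (\<lambda>_. 0))"
    by (subst sum.delta[OF finite_multiindices_le]) (simp add: le_fun_def)
  also have "\<alpha> - (\<lambda>_. 0) = \<alpha>"
    by (simp add: fun_diff_def)
  finally show ?thesis .
qed

lemma mfps_nth_var_mult:
  "mfps_nth (mfps_var i * F) \<alpha> = (if \<alpha> i = 0 then 0 else mfps_nth F (\<alpha>(i := \<alpha> i - 1)))"
proof -
  let ?e = "(\<lambda>_. 0)(i := 1) :: _ \<Rightarrow> nat"
  have "mfps_nth (mfps_var i * F) \<alpha> =
      (\<Sum>\<beta> | \<beta> \<le> \<alpha>. if \<beta> = ?e then mfps_nth F (\<alpha> - \<beta>) else 0)"
    unfolding times_mfps_def mfps_var_def mfps_nth_Abs by (rule sum.cong) auto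
  also have "\<dots> = (if ?e \<le> \<alpha> then mfps_nth F (\<alpha> - ?e) else 0)"
    by (subst sum.delta[OF finite_multiindices_le]) simp
  also have "?e \<le> \<alpha> \<longleftrightarrow> \<alpha> i \<noteq> 0"
    by (auto simp: le_fun_def)
  also have "\<alpha> - ?e = \<alpha>(i := \<alpha> i - 1)"
    by (auto simp: fun_diff_def fun_eq_iff)
  finally show ?thesis by simp
qed

lemma mfps_deriv_add: "mfps_deriv j (F + G) = mfps_deriv j F + mfps_deriv j G"
  by (simp add: mfps_eq_iff mfps_nth_deriv algebra_simps)

lemma mfps_deriv_diff: "mfps_deriv j (F - G) = mfps_deriv j F - mfps_deriv j G"
  by (simp add: mfps_eq_iff mfps_nth_deriv algebra_simps)

lemma mfps_deriv_sum: "mfps_deriv j (sum F A) = (\<Sum>x\<in>A. mfps_deriv j (F x))"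
  by (simp add: mfps_eq_iff mfps_nth_deriv mfps_nth_sum sum_distrib_left)

lemma mfps_deriv_const_mult: "mfps_deriv j (mfps_const c * F) = mfps_const c * mfps_deriv j F"
  by (simp add: mfps_eq_iff mfps_nth_deriv mfps_nth_const_mult mult.left_commute)

lemma mfps_deriv_var_mult:
  "mfps_deriv j (mfps_var i * F) = (if i = j then F else 0) + mfps_var i * mfps_deriv j F"
proof (subst mfps_eq_iff, intro allI)
  fix \<alpha>
  show "mfps_nth (mfps_deriv j (mfps_var i * F)) \<alpha> =
      mfps_nth ((if i = j then F else 0) + mfps_var i * mfps_deriv j F) \<alpha>"
  proof (cases "i = j")
    case True
    then show ?thesis
      by (cases "\<alpha> i") (auto simp: mfps_nth_deriv mfps_nth_var_mult distrib_right fun_upd_idem)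
  next
    case False
    then have "(\<alpha>(i := x, j := y)) = (\<alpha>(j := y, i := x))" for x y
      by (auto simp: fun_eq_iff)
    with False show ?thesis
      by (auto simp: mfps_nth_deriv mfps_nth_var_mult)
  qed
qed

lemma mfps_deriv_var:
  "mfps_deriv j (mfps_var i :: ('a::comm_ring_1, 'v::finite) mfps) = (if i = j then 1 else 0)"
proof -
  have "mfps_deriv j (1 :: ('a, 'v) mfps) = 0"
    by (auto simp: mfps_eq_iff mfps_nth_deriv one_mfps_def fun_eq_iff)
  then show ?thesis
    using mfps_deriv_var_mult[of j i "1 :: ('a, 'v) mfps"] by simp
qed

section \<open>Total degree and order of vanishing\<close>

definition mdeg :: "('v::finite \<Rightarrow> nat) \<Rightarrow> nat" where
  "mdeg \<alpha> = (\<Sum>j\<in>UNIV. \<alpha> j)"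

lemma mdeg_upd: "mdeg (\<alpha>(i := x)) + \<alpha> i = mdeg \<alpha> + x"
  by (simp add: mdeg_def sum.remove[of UNIV i])

lemma le_mdeg: "\<alpha> j \<le> mdeg \<alpha>"
  by (auto simp: mdeg_def intro: member_le_sum)

lemma finite_mdeg_le: "finite {\<alpha>. mdeg \<alpha> \<le> n}"
  by (rule finite_subset[OF _ finite_multiindices_le[of "\<lambda>_. n"]])
    (auto simp: le_fun_def intro: order_trans[OF le_mdeg])

lemma mdeg_diff: "\<beta> \<le> \<alpha> \<Longrightarrow> mdeg (\<alpha> - \<beta>) + mdeg \<beta> = mdeg \<alpha>"
  by (simp add: mdeg_def le_fun_def flip: sum.distrib)

text \<open>Orders of vanishing add under multiplication: in each term of the Cauchy product one
  factor has degree below its bound.\<close>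

lemma mfps_nth_mult_eq_0:
  assumes "\<And>\<beta>. mdeg \<beta> < m \<Longrightarrow> mfps_nth F \<beta> = 0" "\<And>\<beta>. mdeg \<beta> < n \<Longrightarrow> mfps_nth G \<beta> = 0"
    and "mdeg \<alpha> < m + n"
  shows "mfps_nth (F * G) \<alpha> = 0"
  unfolding times_mfps_def mfps_nth_Abs
proof (intro sum.neutral ballI)
  fix \<beta> assume "\<beta> \<in> {\<beta>. \<beta> \<le> \<alpha>}"
  then have "mdeg \<beta> < m \<or> mdeg (\<alpha> - \<beta>) < n"
    using mdeg_diff[of \<beta> \<alpha>] assms(3) by auto
  then show "mfps_nth F \<beta> * mfps_nth G (\<alpha> - \<beta>) = 0"
    using assms(1,2) by auto
qed

lemma mfps_nth_deriv_eq_0: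
  assumes "\<And>\<beta>. mdeg \<beta> < n \<Longrightarrow> mfps_nth F \<beta> = 0" and "mdeg \<alpha> < n - 1"
  shows "mfps_nth (mfps_deriv j F) \<alpha> = 0"
  using assms(1)[of "\<alpha>(j := Suc (\<alpha> j))"] mdeg_upd[of \<alpha> j "Suc (\<alpha> j)"] assms(2)
  by (simp add: mfps_nth_deriv)

section \<open>The bracket with a quadratic Lotka--Volterra field\<close>

lemma lie_bracket_nth:
  "lie_bracket G H $ i =
    (\<Sum>j\<in>UNIV. mfps_deriv j (H $ i) * G $ j) - (\<Sum>j\<in>UNIV. mfps_deriv j (G $ i) * H $ j)"
  by (simp add: lie_bracket_def jacobian_def matrix_vector_mult_def)

lemma lie_bracket_add_right: "lie_bracket G (H + K) = lie_bracket G H + lie_bracket G K"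
  by (simp add: vec_eq_iff lie_bracket_nth mfps_deriv_add algebra_simps sum.distrib)

lemma lie_bracket_diff_left: "lie_bracket (G - H) K = lie_bracket G K - lie_bracket H K"
  by (simp add: vec_eq_iff lie_bracket_nth mfps_deriv_diff algebra_simps sum_subtractf)

lemma lie_bracket_self_multiple: "lie_bracket (mfps_const c *s F) F = 0"
  by (simp add: vec_eq_iff lie_bracket_nth mfps_deriv_const_mult algebra_simps)

text \<open>A derivative lowers the order of vanishing by at most one, so every product in the
  bracket has order at least \<open>m + n - 1\<close>.\<close>

lemma lie_bracket_eq_0_low_degree:
  assumes G: "\<And>k \<beta>. mdeg \<beta> < m \<Longrightarrow> mfps_nth (G $ k) \<beta> = 0"
    and H: "\<And>k \<beta>. mdeg \<beta> < n \<Longrightarrow> mfps_nth (H $ k) \<beta> = 0"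
    and \<alpha>: "mdeg \<alpha> + 1 < m + n"
  shows "mfps_nth (lie_bracket G H $ i) \<alpha> = 0"
proof -
  have "mfps_nth (mfps_deriv j (H $ i) * G $ j) \<alpha> = 0" for j
  proof (rule mfps_nth_mult_eq_0[where m = "n - 1" and n = m])
    show "mfps_nth (mfps_deriv j (H $ i)) \<beta> = 0" if "mdeg \<beta> < n - 1" for \<beta>
      using H that by (rule mfps_nth_deriv_eq_0)
  qed (use G \<alpha> in auto)
  moreover have "mfps_nth (mfps_deriv j (G $ i) * H $ j) \<alpha> = 0" for j
  proof (rule mfps_nth_mult_eq_0[where m = "m - 1" and n = n])
    show "mfps_nth (mfps_deriv j (G $ i)) \<beta> = 0" if "mdeg \<beta> < m - 1" for \<beta>
      using G that by (rule mfps_nth_deriv_eq_0)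
  qed (use H \<alpha> in auto)
  ultimately show ?thesis
    by (simp add: lie_bracket_nth mfps_nth_sum)
qed

lemma quadratic_vf_nth:
  "quadratic_vf \<nu> $ i = (\<Sum>j\<in>UNIV. mfps_const (\<nu> $ i $ j) * (mfps_var i * mfps_var j))"
  by (simp add: quadratic_vf_def sum_distrib_left mult.left_commute)

text \<open>The product rule splits the derivative of y_i (\<Sum> \<nu>_ij y_j): the first sum
  differentiates the factor y_i, the second the linear form. The third sum is arranged so that only
  the Euler operators y_k d/dy_k act on \<open>G\<close>; these are diagonal on monomials.\<close>

lemma lie_bracket_quadratic_vf:
  fixes \<nu> :: "complex ^ 'r ^ 'r::finite"
  shows "lie_bracket G (quadratic_vf \<nu>) $ i =
    (\<Sum>j\<in>UNIV. mfps_const (\<nu> $ i $ j) * (mfps_var j * G $ i)) +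
    (\<Sum>k\<in>UNIV. mfps_const (\<nu> $ i $ k) * (mfps_var i * G $ k)) -
    (\<Sum>j\<in>UNIV. \<Sum>k\<in>UNIV. mfps_const (\<nu> $ k $ j) *
      (mfps_var j * (mfps_var k * mfps_deriv k (G $ i))))"
proof -
  have "mfps_deriv k (quadratic_vf \<nu> $ i) = 
      (\<Sum>j\<in>UNIV. mfps_const (\<nu> $ i $ j) * (if i = k then mfps_var j else 0)) +
      mfps_const (\<nu> $ i $ k) * mfps_var i" for k
  proof -
    have "(\<Sum>j\<in>UNIV. mfps_const (\<nu> $ i $ j) * (mfps_var i * (if j = k then 1 else 0))) =
        mfps_const (\<nu> $ i $ k) * mfps_var i"
      by (subst sum.remove[of _ k]) auto
    then show ?thesis
      by (simp add: quadratic_vf_nth mfps_deriv_sum mfps_deriv_const_mult mfps_deriv_var_mult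
          mfps_deriv_var distrib_left sum.distrib)
  qed
  then have "(\<Sum>k\<in>UNIV. mfps_deriv k (quadratic_vf \<nu> $ i) * G $ k) =
      (\<Sum>k\<in>UNIV. if i = k then \<Sum>j\<in>UNIV. mfps_const (\<nu> $ i $ j) * (mfps_var j * G $ k) else 0) +
      (\<Sum>k\<in>UNIV. mfps_const (\<nu> $ i $ k) * (mfps_var i * G $ k))"
    unfolding sum.distrib[symmetric]
    by (intro sum.cong) (auto simp: distrib_right sum_distrib_right mult.assoc)
  moreover have "(\<Sum>k\<in>UNIV. mfps_deriv k (G $ i) * quadratic_vf \<nu> $ k) =
      (\<Sum>j\<in>UNIV. \<Sum>k\<in>UNIV. mfps_const (\<nu> $ k $ j) *
        (mfps_var j * (mfps_var k * mfps_deriv k (G $ i))))"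
    by (subst sum.swap) (simp add: quadratic_vf_nth sum_distrib_left algebra_simps)
  ultimately show ?thesis
    by (simp add: lie_bracket_nth)
qed

text \<open>The factor in the first sum is the eigenvalue of D_j on the vector monomial y^(\<beta> -
  e_j) e_i. The second sum is the correction from differentiating the factor y_k of y_k D_k. The
  value 0 is used where the exponent cannot be lowered.\<close>

lemma mfps_nth_lie_bracket_quadratic_vf:
  fixes \<nu> :: "complex ^ 'r ^ 'r::finite"
  shows "mfps_nth (lie_bracket G (quadratic_vf \<nu>) $ i) \<beta> =
    (\<Sum>j\<in>UNIV. if \<beta> j = 0 then 0 else
      (\<nu> $ i $ j - (\<Sum>k\<in>UNIV. \<nu> $ k $ j * of_nat ((\<beta>(j := \<beta> j - 1)) k))) *
      mfps_nth (G $ i) (\<beta>(j := \<beta> j - 1))) +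
    (\<Sum>k\<in>UNIV. if \<beta> i = 0 then 0 else \<nu> $ i $ k * mfps_nth (G $ k) (\<beta>(i := \<beta> i - 1)))"
proof -
  have euler: "mfps_nth (mfps_var k * mfps_deriv k (G $ i)) \<gamma> = of_nat (\<gamma> k) * mfps_nth (G $ i) \<gamma>"
    for k \<gamma> by (auto simp: mfps_nth_var_mult mfps_nth_deriv fun_upd_idem)
  have sum_euler: "(\<Sum>k\<in>UNIV. \<nu> $ k $ j * mfps_nth (mfps_var j * (mfps_var k * mfps_deriv k (G $ i))) \<beta>) =
      (if \<beta> j = 0 then 0 else (\<Sum>k\<in>UNIV. \<nu> $ k $ j * of_nat ((\<beta>(j := \<beta> j - 1)) k)) *
        mfps_nth (G $ i) (\<beta>(j := \<beta> j - 1)))" for j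
    by (subst mfps_nth_var_mult) (simp only: euler sum_distrib_right mult.assoc, simp)
  let ?A = "\<lambda>j. \<nu> $ i $ j * mfps_nth (mfps_var j * G $ i) \<beta>"
  let ?B = "\<Sum>k\<in>UNIV. \<nu> $ i $ k * mfps_nth (mfps_var i * G $ k) \<beta>"
  let ?C = "\<lambda>j. if \<beta> j = 0 then 0 else (\<Sum>k\<in>UNIV. \<nu> $ k $ j * of_nat ((\<beta>(j := \<beta> j - 1)) k)) *
    mfps_nth (G $ i) (\<beta>(j := \<beta> j - 1))"
  have "mfps_nth (lie_bracket G (quadratic_vf \<nu>) $ i) \<beta> = sum ?A UNIV + ?B - sum ?C UNIV"
    unfolding lie_bracket_quadratic_vf mfps_nth_sum mfps_nth_const_mult mfps_nth_add mfps_nth_diff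
      sum_euler ..
  also have "\<dots> = (\<Sum>j\<in>UNIV. ?A j - ?C j) + ?B"
    by (simp only: sum_subtractf) (simp only: diff_conv_add_uminus ac_simps)
  also have "(\<Sum>j\<in>UNIV. ?A j - ?C j) = (\<Sum>j\<in>UNIV. if \<beta> j = 0 then 0 else
      (\<nu> $ i $ j - (\<Sum>k\<in>UNIV. \<nu> $ k $ j * of_nat ((\<beta>(j := \<beta> j - 1)) k))) *
      mfps_nth (G $ i) (\<beta>(j := \<beta> j - 1)))"
    by (intro sum.cong refl, subst mfps_nth_var_mult) (simp only: left_diff_distrib split: if_split, simp)
  also have "?B = (\<Sum>k\<in>UNIV. if \<beta> i = 0 then 0 else
      \<nu> $ i $ k * mfps_nth (G $ k) (\<beta>(i := \<beta> i - 1)))"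
    by (intro sum.cong refl) (simp add: mfps_nth_var_mult)
  finally show ?thesis .
qed

lemma mfps_nth_quadratic_vf_diag:
  "mfps_nth (quadratic_vf \<nu> $ p) ((\<lambda>_. 0)(p := 2)) = \<nu> $ p $ p"
proof -
  have "mfps_nth (mfps_const (\<nu> $ p $ j) * (mfps_var p * mfps_var j)) ((\<lambda>_. 0)(p := 2)) =
      (if j = p then \<nu> $ p $ p else 0)" for j
    unfolding mfps_nth_const_mult mfps_nth_var_mult by (auto simp: mfps_var_def fun_eq_iff)
  then show ?thesis
    by (simp add: quadratic_vf_nth mfps_nth_sum)
qed

lemma homogeneous_part_nth:
  "mfps_nth (homogeneous_part k F $ i) \<alpha> = (if mdeg \<alpha> = k then mfps_nth (F $ i) \<alpha> else 0)"
  by (simp add: homogeneous_part_def mdeg_def)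

lemma starts_with_quadratic_low_degree:
  assumes "starts_with_quadratic \<nu> F" and "mdeg \<alpha> < 3"
  shows "mfps_nth (F $ i) \<alpha> = mfps_nth (quadratic_vf \<nu> $ i) \<alpha>"
proof -
  have part: "homogeneous_part 0 F = 0" "homogeneous_part 1 F = 0"
      "homogeneous_part 2 F = quadratic_vf \<nu>"
    using assms(1) by (auto simp: starts_with_quadratic_def)
  consider "mdeg \<alpha> = 0" | "mdeg \<alpha> = 1" | "mdeg \<alpha> = 2"
    using assms(2) by linarith
  then show ?thesis
    using homogeneous_part_nth[of 0 F i \<alpha>] homogeneous_part_nth[of 1 F i \<alpha>]
      homogeneous_part_nth[of 2 F i \<alpha>]
    unfolding part by cases auto
qed

section \<open>Nonresonant coefficient matrices\<close>

text \<open>The relations are those excluded in the argument below: \<open>\<kappa>\<close> = 2 e_p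
  and \<open>\<kappa>\<close> = e_i express vanishing eigenvalues, and \<open>\<kappa>\<close> = 0
  makes the diagonal entries of \<open>\<nu>\<close> nonzero. Bounding the degree of
  \<open>\<kappa>\<close> leaves only finitely many relations to avoid near the all-ones
  matrix.\<close>

definition nonresonant :: "complex ^ 'r ^ 'r::finite \<Rightarrow> bool" where
  "nonresonant \<nu> \<longleftrightarrow> (\<forall>p \<alpha> \<kappa>. mdeg \<kappa> \<le> 2 \<longrightarrow> \<alpha> \<noteq> \<kappa> \<longrightarrow>
    (\<Sum>j\<in>UNIV. \<nu> $ j $ p * of_nat (\<alpha> j)) \<noteq> (\<Sum>j\<in>UNIV. \<nu> $ j $ p * of_nat (\<kappa> j)))"

lemma nonresonantD:
  assumes "nonresonant \<nu>" "mdeg \<kappa> \<le> 2"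
    and "(\<Sum>j\<in>UNIV. \<nu> $ j $ p * of_nat (\<alpha> j)) = (\<Sum>j\<in>UNIV. \<nu> $ j $ p * of_nat (\<kappa> j))"
  shows "\<alpha> = \<kappa>"
  using assms(1)[unfolded nonresonant_def, rule_format, OF assms(2)] assms(3) by metis

section \<open>The lowest homogeneous part of a commuting field\<close>

context
  fixes \<nu> :: "complex ^ 'r ^ 'r::finite" and F G :: "'r formal_vf" and s :: nat
  assumes nonres: "nonresonant \<nu>" and F: "starts_with_quadratic \<nu> F"
    and commute: "lie_bracket G F = 0"
    and low: "\<And>k \<beta>. mdeg \<beta> < s \<Longrightarrow> mfps_nth (G $ k) \<beta> = 0"
begin

text \<open>The field \<open>F - quadratic_vf \<nu>\<close> has order at least 3, so its bracket
  with \<open>G\<close> has order at least s + 2 and does not reach degree s + 1.\<close>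

lemma lowest_part_commutes:
  assumes "mdeg \<beta> = Suc s"
  shows "mfps_nth (lie_bracket G (quadratic_vf \<nu>) $ i) \<beta> = 0"
proof -
  have "mfps_nth (lie_bracket G (F - quadratic_vf \<nu>) $ i) \<beta> = 0"
    by (rule lie_bracket_eq_0_low_degree[where m = s and n = 3])
      (use assms low starts_with_quadratic_low_degree[OF F] in auto)
  then show ?thesis
    using commute lie_bracket_add_right[of G "quadratic_vf \<nu>" "F - quadratic_vf \<nu>"]
    by (simp add: vec_eq_iff mfps_eq_iff) (metis add.right_neutral)
qed

text \<open>
  The torus weight of the vector monomial \<open>y\<^sup>\<alpha> e\<^sub>i\<close> is \<open>\<alpha> - e\<^sub>i\<close>, and the bracket with
  \<open>y\<^sub>p D\<^sub>p\<close> shifts weights by \<open>e\<^sub>p\<close>. If the \<open>p\<close>-th entry of a weight is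
  maximal, no other summand of the quadratic part contributes to the shifted weight.
\<close>

lemma maximal_weight:
  assumes "mdeg \<alpha> = s" and nz: "mfps_nth (G $ i) \<alpha> \<noteq> 0"
    and maximal: "\<forall>k \<gamma>. mdeg \<gamma> = s \<longrightarrow> mfps_nth (G $ k) \<gamma> \<noteq> 0 \<longrightarrow>
      int (\<gamma> p) - of_bool (k = p) \<le> int (\<alpha> p) - of_bool (i = p)"
  shows "s = 2 \<and> mfps_nth (G $ p) ((\<lambda>_. 0)(p := 2)) \<noteq> 0 \<or> i \<noteq> p \<and> \<alpha> = (\<lambda>_. 0)(i := 1)"
proof -
  note max = maximal[rule_format]
  \<comment> \<open>A maximal monomial in direction e_p is treated first; its weight has p-th entry
    \<gamma>_p - 1.\<close>
  have diag: "s = 2 \<and> \<gamma> = (\<lambda>_. 0)(p := 2)"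
    if \<gamma>: "mdeg \<gamma> = s" "mfps_nth (G $ p) \<gamma> \<noteq> 0" 
      and max: "\<And>k \<delta>. mdeg \<delta> = s \<Longrightarrow> mfps_nth (G $ k) \<delta> \<noteq> 0 \<Longrightarrow>
        int (\<delta> p) - of_bool (k = p) \<le> int (\<gamma> p) - 1" for \<gamma>
  proof -
    let ?\<beta> = "\<gamma>(p := Suc (\<gamma> p))"
    have deg: "mdeg ?\<beta> = Suc s"
      using mdeg_upd[of \<gamma> p "Suc (\<gamma> p)"] \<gamma> by simp
    \<comment> \<open>Lowering an exponent other than the p-th keeps \<gamma>_p + 1 at p, and
      replacing e_p by another direction drops the -1. Both would exceed the maximal weight.\<close>
    have *: "mfps_nth (G $ p) (?\<beta>(j := ?\<beta> j - 1)) = 0" if "j \<noteq> p" "?\<beta> j \<noteq> 0" for j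
      using max[of "?\<beta>(j := ?\<beta> j - 1)" p] mdeg_upd[of ?\<beta> j "?\<beta> j - 1"] deg that by fastforce
    have **: "mfps_nth (G $ k) \<gamma> = 0" if "k \<noteq> p" for k
      using max[of \<gamma> k] \<gamma> that by fastforce
    \<comment> \<open>Only the monomial itself contributes, once through the eigenvalue of D_p and
      once through the correction term; together they give 2 \<nu>_pp, which is why
      \<open>\<gamma>\<close> must be 2 e_p.\<close>
    have "0 = (\<nu> $ p $ p - (\<Sum>k\<in>UNIV. \<nu> $ k $ p * of_nat (\<gamma> k))) * mfps_nth (G $ p) \<gamma> +
        \<nu> $ p $ p * mfps_nth (G $ p) \<gamma>"
    proof -
      note lowest_part_commutes[OF deg, of p, symmetric]
      also note mfps_nth_lie_bracket_quadratic_vf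
      also have "(\<Sum>j\<in>UNIV. if ?\<beta> j = 0 then 0 else
          (\<nu> $ p $ j - (\<Sum>k\<in>UNIV. \<nu> $ k $ j * of_nat ((?\<beta>(j := ?\<beta> j - 1)) k))) *
          mfps_nth (G $ p) (?\<beta>(j := ?\<beta> j - 1))) =
          (\<nu> $ p $ p - (\<Sum>k\<in>UNIV. \<nu> $ k $ p * of_nat (\<gamma> k))) * mfps_nth (G $ p) \<gamma>"
        by (subst sum.remove[of _ p], simp, simp, subst sum.neutral) (use * in auto)
      also have "(\<Sum>k\<in>UNIV. if ?\<beta> p = 0 then 0 else
          \<nu> $ p $ k * mfps_nth (G $ k) (?\<beta>(p := ?\<beta> p - 1))) = \<nu> $ p $ p * mfps_nth (G $ p) \<gamma>"
        by (subst sum.remove[of _ p], simp, simp) (use ** in auto)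
      finally show ?thesis .
    qed
    then have "(2 * \<nu> $ p $ p - (\<Sum>k\<in>UNIV. \<nu> $ k $ p * of_nat (\<gamma> k))) * mfps_nth (G $ p) \<gamma> = 0"
      by (simp only: mult_2 distrib_right left_diff_distrib) simp
    then have eq: "(\<Sum>k\<in>UNIV. \<nu> $ k $ p * of_nat (\<gamma> k)) = 2 * \<nu> $ p $ p"
      using \<gamma> by simp
    have "(\<Sum>k\<in>UNIV. \<nu> $ k $ p * of_nat (((\<lambda>_. 0)(p := 2)) k)) = 2 * \<nu> $ p $ p"
      by (subst sum.remove[of _ p]) auto
    moreover have deg2: "mdeg ((\<lambda>_::'r. 0)(p := 2)) = 2"
      using mdeg_upd[of "\<lambda>_::'r. 0" p 2] by (simp add: mdeg_def)
    ultimately have "\<gamma> = (\<lambda>_. 0)(p := 2)"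
      using eq by (intro nonresonantD[OF nonres, where p = p]) auto
    then show ?thesis
      using \<gamma> deg2 by simp
  qed
  show ?thesis
  proof (cases "i = p")
    case True
    then show ?thesis
      using diag[of \<alpha>] assms(1) nz max by auto
  next
    case False
    \<comment> \<open>The exponent \<open>?\<gamma>\<close> is the one at which the correction terms
      for y^\<beta> e_i read the coefficients of \<open>G\<close>.\<close>
    let ?\<beta> = "\<alpha>(p := Suc (\<alpha> p))" and ?\<gamma> = "\<alpha>(p := Suc (\<alpha> p), i := \<alpha> i - 1)"
    have deg: "mdeg ?\<beta> = Suc s"
      using mdeg_upd[of \<alpha> p "Suc (\<alpha> p)"] assms(1) by simp
    have *: "mfps_nth (G $ i) (?\<beta>(j := ?\<beta> j - 1)) = 0" if "j \<noteq> p" "?\<beta> j \<noteq> 0" for j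
      using max[of "?\<beta>(j := ?\<beta> j - 1)" i] mdeg_upd[of ?\<beta> j "?\<beta> j - 1"] deg that False by fastforce
    have deg\<gamma>: "mdeg ?\<gamma> = s" if "\<alpha> i \<noteq> 0"
      using mdeg_upd[of ?\<beta> i "\<alpha> i - 1"] deg that False by simp
    have **: "mfps_nth (G $ k) ?\<gamma> = 0" if "k \<noteq> p" "\<alpha> i \<noteq> 0" for k
      using max[of ?\<gamma> k] deg\<gamma> that False by fastforce
    show ?thesis
    \<comment> \<open>The only correction term that can survive has direction e_p. Its weight has
      the same p-th entry \<alpha>_p, so if present it is maximal too and \<open>diag\<close>
      applies; otherwise the eigenvalue of D_p on y^\<alpha> e_i vanishes.\<close>
    proof (cases "\<alpha> i \<noteq> 0 \<and> mfps_nth (G $ p) ?\<gamma> \<noteq> 0")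
      case True
      then show ?thesis
        using diag[of ?\<gamma>] deg\<gamma> max False by auto
    next
      case no_diag: False
      note lowest_part_commutes[OF deg, of i, symmetric]
      also note mfps_nth_lie_bracket_quadratic_vf
      also have "(\<Sum>j\<in>UNIV. if ?\<beta> j = 0 then 0 else
          (\<nu> $ i $ j - (\<Sum>k\<in>UNIV. \<nu> $ k $ j * of_nat ((?\<beta>(j := ?\<beta> j - 1)) k))) *
          mfps_nth (G $ i) (?\<beta>(j := ?\<beta> j - 1))) =
          (\<nu> $ i $ p - (\<Sum>k\<in>UNIV. \<nu> $ k $ p * of_nat (\<alpha> k))) * mfps_nth (G $ i) \<alpha>"
        by (subst sum.remove[of _ p], simp, simp, subst sum.neutral) (use * in auto)
      also have "(\<Sum>k\<in>UNIV. if ?\<beta> i = 0 then 0 else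
          \<nu> $ i $ k * mfps_nth (G $ k) (?\<beta>(i := ?\<beta> i - 1))) = 0"
        using ** no_diag False by (intro sum.neutral) (metis fun_upd_other mult_zero_right)
      finally have "(\<Sum>k\<in>UNIV. \<nu> $ k $ p * of_nat (\<alpha> k)) = \<nu> $ i $ p"
        using nz by simp
      moreover have "(\<Sum>k\<in>UNIV. \<nu> $ k $ p * of_nat (((\<lambda>_. 0)(i := 1)) k)) = \<nu> $ i $ p"
        by (subst sum.remove[of _ i]) auto
      moreover have "mdeg ((\<lambda>_::'r. 0)(i := 1)) \<le> 2"
        using mdeg_upd[of "\<lambda>_::'r. 0" i 1] by (simp add: mdeg_def)
      ultimately have "\<alpha> = (\<lambda>_. 0)(i := 1)"
        by (intro nonresonantD[OF nonres, where p = p]) auto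
      with False show ?thesis by simp
    qed
  qed
qed

text \<open>A monomial of maximal p-th weight gives the claim unless it is some y_k e_k. That
  exception is ruled out by maximizing the k-th weight entry instead.\<close>

lemma lowest_part_quadratic:
  assumes "mdeg \<alpha> = s" and "mfps_nth (G $ i) \<alpha> \<noteq> 0"
  shows "s = 2 \<and> mfps_nth (G $ p) ((\<lambda>_. 0)(p := 2)) \<noteq> 0"
proof -
  let ?S = "{(k, \<gamma>). mdeg \<gamma> = s \<and> mfps_nth (G $ k) \<gamma> \<noteq> 0}"
  have "finite ?S"
    by (rule finite_subset[of _ "UNIV \<times> {\<gamma>. mdeg \<gamma> \<le> s}"]) (auto intro: finite_mdeg_le)
  have ex: "\<exists>k \<gamma>. mdeg \<gamma> = s \<and> mfps_nth (G $ k) \<gamma> \<noteq> 0 \<and>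
      (\<forall>l \<delta>. mdeg \<delta> = s \<longrightarrow> mfps_nth (G $ l) \<delta> \<noteq> 0 \<longrightarrow>
        int (\<delta> p) - of_bool (l = p) \<le> int (\<gamma> p) - of_bool (k = p))" for p
  proof -
    define w where "w = (\<lambda>(k, \<gamma>). int (\<gamma> p) - of_bool (k = p))"
    have "Max (w ` ?S) \<in> w ` ?S"
      using \<open>finite ?S\<close> assms by (intro Max_in) auto
    then obtain k \<gamma> where *: "(k, \<gamma>) \<in> ?S" "Max (w ` ?S) = w (k, \<gamma>)"
      by auto
    have "w y \<le> w (k, \<gamma>)" if "y \<in> ?S" for y
      unfolding *(2)[symmetric] using \<open>finite ?S\<close> that by (intro Max_ge) auto
    then have "w (l, \<delta>) \<le> w (k, \<gamma>)" if "mdeg \<delta> = s" "mfps_nth (G $ l) \<delta> \<noteq> 0" for l \<delta>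
      using that by blast
    then show ?thesis
      using *(1) unfolding w_def by (intro exI[of _ k] exI[of _ \<gamma>]) simp
  qed
  obtain k \<gamma> where k: "mdeg \<gamma> = s" "mfps_nth (G $ k) \<gamma> \<noteq> 0"
    and k_max: "\<forall>l \<delta>. mdeg \<delta> = s \<longrightarrow> mfps_nth (G $ l) \<delta> \<noteq> 0 \<longrightarrow>
        int (\<delta> p) - of_bool (l = p) \<le> int (\<gamma> p) - of_bool (k = p)"
    using ex[of p] by blast
  have False if \<gamma>: "\<gamma> = (\<lambda>_. 0)(k := 1)"
  proof -
    have "mdeg \<gamma> = 1"
      unfolding \<gamma> using mdeg_upd[of "\<lambda>_::'r. 0" k 1] by (simp add: mdeg_def)
    obtain l \<delta> where l: "mdeg \<delta> = s" "mfps_nth (G $ l) \<delta> \<noteq> 0"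
      and l_max: "\<forall>m \<epsilon>. mdeg \<epsilon> = s \<longrightarrow> mfps_nth (G $ m) \<epsilon> \<noteq> 0 \<longrightarrow>
          int (\<epsilon> k) - of_bool (m = k) \<le> int (\<delta> k) - of_bool (l = k)"
      using ex[of k] by blast
    have "l \<noteq> k \<and> \<delta> = (\<lambda>_. 0)(l := 1)"
      using maximal_weight[OF l l_max] \<open>mdeg \<gamma> = 1\<close> k by auto
    \<comment> \<open>The monomials y_l e_l and y_k e_k both have weight 0. Hence y_k e_k is itself
      maximal for entry k, where the exceptional case would require k \<noteq> k, while s = 1
      excludes the other case.\<close>
    then have "int (\<delta> k) - of_bool (l = k) = int (\<gamma> k) - of_bool (k = k)"
      by (auto simp: \<gamma>)
    with l_max have "\<forall>m \<epsilon>. mdeg \<epsilon> = s \<longrightarrow> mfps_nth (G $ m) \<epsilon> \<noteq> 0 \<longrightarrow>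
        int (\<epsilon> k) - of_bool (m = k) \<le> int (\<gamma> k) - of_bool (k = k)"
      by (simp only:)
    from maximal_weight[OF k this] show False
      using \<open>mdeg \<gamma> = 1\<close> k by auto
  qed
  then show ?thesis
    using maximal_weight[OF k k_max] by blast
qed

end

text \<open>Subtracting a multiple of \<open>F\<close> from \<open>G\<close> preserves commutation
  and can cancel the coefficient of y_p^2 e_p for one index p. A nonzero lowest part of the
  difference would need that coefficient to be nonzero.\<close>

lemma nonresonant_imp_R_hat:
  fixes \<nu> :: "complex ^ 'r ^ 'r::finite"
  assumes nonres: "nonresonant \<nu>"
  shows "\<nu> \<in> R_hat"
proof -
  have "G \<in> range (\<lambda>c. mfps_const c *s F)"
    if F: "starts_with_quadratic \<nu> F" and "lie_bracket G F = 0" for F G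
  proof -
    fix p :: 'r
    let ?d = "(\<lambda>_::'r. 0)(p := 2::nat)"
    have d: "mdeg ?d = 2"
      using mdeg_upd[of "\<lambda>_::'r. 0" p 2] by (simp add: mdeg_def)
    have "\<nu> $ p $ p \<noteq> 0"
    proof
      assume "\<nu> $ p $ p = 0"
      then have "(\<Sum>j\<in>UNIV. \<nu> $ j $ p * of_nat (?d j)) = (\<Sum>j\<in>UNIV. \<nu> $ j $ p * of_nat 0)"
        by (auto intro!: sum.neutral)
      then have "?d = (\<lambda>_. 0)"
        by (intro nonresonantD[OF nonres, where p = p]) (auto simp: mdeg_def)
      then show False
        by (metis fun_upd_same zero_neq_numeral)
    qed
    define c where "c = mfps_nth (G $ p) ?d / \<nu> $ p $ p"
    define H where "H = G - mfps_const c *s F"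
    have H_comm: "lie_bracket H F = 0"
      using that by (simp add: H_def lie_bracket_diff_left lie_bracket_self_multiple)
    have "mfps_nth (F $ p) ?d = \<nu> $ p $ p"
      using starts_with_quadratic_low_degree[OF F, of ?d p] d
      by (simp add: mfps_nth_quadratic_vf_diag)
    then have H_diag: "mfps_nth (H $ p) ?d = 0"
      using \<open>\<nu> $ p $ p \<noteq> 0\<close> by (simp add: H_def c_def mfps_nth_const_mult)
    \<comment> \<open>Strong induction on the degree supplies the vanishing in lower degrees that
      makes \<open>mdeg \<alpha>\<close> an admissible value of \<open>s\<close>.\<close>
    have "mfps_nth (H $ i) \<alpha> = 0" for i \<alpha>
    proof (induction "mdeg \<alpha>" arbitrary: i \<alpha> rule: less_induct)
      case less
      then show ?case
        using lowest_part_quadratic[OF nonres F H_comm, of "mdeg \<alpha>" \<alpha> i p] H_diag by blast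
    qed
    then have "G = mfps_const c *s F"
      by (simp add: H_def vec_eq_iff mfps_eq_iff)
    then show ?thesis by blast
  qed
  then show ?thesis
    by (auto simp: R_hat_def formal_centralizer_def lie_bracket_self_multiple)
qed

lemma negligible_resonant: "negligible {\<nu> :: complex ^ 'r ^ 'r::finite. \<not> nonresonant \<nu>}"
proof -
  let ?N = "\<lambda>(p, \<alpha>, \<kappa>). {\<nu> :: complex ^ 'r ^ 'r.
    (\<Sum>j\<in>UNIV. \<nu> $ j $ p * of_nat (\<alpha> j)) = (\<Sum>j\<in>UNIV. \<nu> $ j $ p * of_nat (\<kappa> j))}"
  let ?I = "{(p, \<alpha>, \<kappa>). \<alpha> \<noteq> \<kappa>} :: ('r \<times> ('r \<Rightarrow> nat) \<times> ('r \<Rightarrow> nat)) set"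
  have "negligible (?N (p, \<alpha>, \<kappa>))" if "\<alpha> \<noteq> \<kappa>" for p and \<alpha> \<kappa> :: "'r \<Rightarrow> nat"
  proof -
    \<comment> \<open>The real normal vector of the hyperplane given by the real part of the
      relation; containment in this one real hyperplane already yields measure zero.\<close>
    define a :: "complex ^ 'r ^ 'r" where
      "a = (\<chi> j q. if q = p then of_real (real (\<alpha> j) - real (\<kappa> j)) else 0)"
    have "a \<bullet> \<nu> = Re (\<Sum>j\<in>UNIV. \<nu> $ j $ p * of_nat (\<alpha> j)) - Re (\<Sum>j\<in>UNIV. \<nu> $ j $ p * of_nat (\<kappa> j))"
      for \<nu>
    proof -
      have "(\<Sum>q\<in>UNIV. a $ j $ q \<bullet> \<nu> $ j $ q) = (real (\<alpha> j) - real (\<kappa> j)) * Re (\<nu> $ j $ p)" for j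
        by (subst sum.remove[of _ p]) (auto simp: a_def inner_complex_def)
      then show ?thesis
        by (simp add: inner_vec_def right_diff_distrib sum_subtractf mult.commute)
    qed
    then have "?N (p, \<alpha>, \<kappa>) \<subseteq> {\<nu>. a \<bullet> \<nu> = 0}"
      by (simp add: subset_iff del: Re_sum)
    moreover obtain j where "\<alpha> j \<noteq> \<kappa> j"
      using \<open>\<alpha> \<noteq> \<kappa>\<close> by (auto simp: fun_eq_iff)
    then have "a $ j $ p \<noteq> 0"
      by (simp add: a_def)
    then have "a \<noteq> 0"
      by auto
    ultimately show ?thesis
      using negligible_hyperplane[of a 0] negligible_subset by blast
  qed
  \<comment> \<open>The index set is countable because exponents are functions from a finite type to
    \<open>nat\<close>.\<close>
  then have "negligible (\<Union>(?N ` ?I))"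
    by (intro negligible_countable_Union) auto
  then show ?thesis
    by (rule negligible_subset) (auto simp: nonresonant_def)
qed

section \<open>An open set of nonresonant matrices\<close>

text \<open>With every a_j replaced by 1 the two sums differ by the difference of the degrees, and
  the error is at most a sixth of their sum. Equality would give 5 |\<alpha>| \<le> 7 |\<kappa>|,
  that is 15 \<le> 14 in the extreme case.\<close>

lemma nonresonant_near_one:
  fixes a :: "'r::finite \<Rightarrow> complex"
  assumes near: "\<And>j. cmod (a j - 1) < 1 / 6" and "mdeg \<kappa> \<le> 2" "mdeg \<alpha> > 2"
  shows "(\<Sum>j\<in>UNIV. a j * of_nat (\<alpha> j)) \<noteq> (\<Sum>j\<in>UNIV. a j * of_nat (\<kappa> j))"
proof
  assume eq: "(\<Sum>j\<in>UNIV. a j * of_nat (\<alpha> j)) = (\<Sum>j\<in>UNIV. a j * of_nat (\<kappa> j))"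
  have sums: "(\<Sum>j\<in>UNIV. real (\<gamma> j)) = real (mdeg \<gamma>)" for \<gamma> :: "'r \<Rightarrow> nat"
    by (simp add: mdeg_def)
  have "(\<Sum>j\<in>UNIV. (a j - 1) * (of_nat (\<alpha> j) - of_nat (\<kappa> j))) =
      of_nat (mdeg \<kappa>) - of_nat (mdeg \<alpha>)"
    using eq by (simp add: algebra_simps sum_subtractf sum.distrib mdeg_def)
  then have "real (mdeg \<alpha>) - real (mdeg \<kappa>) =
      cmod (\<Sum>j\<in>UNIV. (a j - 1) * (of_nat (\<alpha> j) - of_nat (\<kappa> j)))"
    using assms(2,3)
    by (metis (no_types, lifting) abs_of_nonneg diff_ge_0_iff_ge le_trans less_imp_le_nat norm_minus_commute norm_of_real
        of_nat_le_iff of_real_diff of_real_of_nat_eq)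
  also have "\<dots> \<le> (\<Sum>j\<in>UNIV. 1 / 6 * (real (\<alpha> j) + real (\<kappa> j)))"
  proof (rule sum_norm_le)
    fix j
    have "cmod (of_nat (\<alpha> j) - of_nat (\<kappa> j)) \<le> real (\<alpha> j) + real (\<kappa> j)"
      by (rule norm_triangle_le_diff) simp
    then show "cmod ((a j - 1) * (of_nat (\<alpha> j) - of_nat (\<kappa> j))) \<le> 1 / 6 * (real (\<alpha> j) + real (\<kappa> j))"
      unfolding norm_mult using near[of j] by (intro mult_mono) auto
  qed
  also have "\<dots> = (real (mdeg \<alpha>) + real (mdeg \<kappa>)) / 6"
    by (simp add: sum.distrib sums flip: sum_divide_distrib)
  finally have "real (mdeg \<alpha>) - real (mdeg \<kappa>) \<le> (real (mdeg \<alpha>) + real (mdeg \<kappa>)) / 6" .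
  moreover have "real (mdeg \<alpha>) \<ge> 3" "real (mdeg \<kappa>) \<le> 2"
    using assms(2,3) by linarith+
  ultimately show False
    by (simp add: field_simps)
qed

text \<open>On \<open>B\<close> only relations with both degrees at most 2 can hold. There are
  finitely many, and each one removes a closed set.\<close>

lemma open_nonresonant_subset:
  "\<exists>U :: (complex ^ 'r ^ 'r::finite) set. open U \<and> U \<noteq> {} \<and> U \<subseteq> {\<nu>. nonresonant \<nu>}"
proof -
  define B where "B = {\<nu> :: complex ^ 'r ^ 'r. \<forall>p j. cmod (\<nu> $ j $ p - 1) < 1 / 6}"
  define V where "V = (\<lambda>(p, \<alpha>, \<kappa>). {\<nu> :: complex ^ 'r ^ 'r.
    (\<Sum>j\<in>UNIV. \<nu> $ j $ p * of_nat (\<alpha> j)) \<noteq> (\<Sum>j\<in>UNIV. \<nu> $ j $ p * of_nat (\<kappa> j))})"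
  define I where "I = {(p :: 'r, \<alpha>, \<kappa> :: 'r \<Rightarrow> nat). mdeg \<alpha> \<le> 2 \<and> mdeg \<kappa> \<le> 2 \<and> \<alpha> \<noteq> \<kappa>}"
  have "B = (\<Inter>p. \<Inter>j. {\<nu>. cmod (\<nu> $ j $ p - 1) < 1 / 6})"
    by (auto simp: B_def)
  also have "open \<dots>"
    by (intro open_INT ballI finite open_Collect_less continuous_intros)
  finally have "open B" .
  have "finite I"
    by (rule finite_subset[of _ "UNIV \<times> {\<alpha>. mdeg \<alpha> \<le> 2} \<times> {\<alpha>. mdeg \<alpha> \<le> 2}"])
      (auto simp: I_def intro!: finite_cartesian_product finite_mdeg_le)
  moreover have "open (V x)" for x
    by (cases x) (auto simp: V_def intro!: open_Collect_neq continuous_intros)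
  ultimately have "open (B \<inter> (\<Inter>x\<in>I. V x))"
    using \<open>open B\<close> by (intro open_Int open_INT) auto
  moreover have "B \<inter> (\<Inter>x\<in>I. V x) \<noteq> {}"
  proof -
    \<comment> \<open>The all-ones matrix only shows that \<open>B\<close> is nonempty; a
      nonresonant point of \<open>B\<close> comes from measure, since a nonempty open set is not
      negligible.\<close>
    have "(\<chi> i j. 1) \<in> B"
      by (simp add: B_def)
    then have "\<not> negligible B"
      using \<open>open B\<close> open_not_negligible by blast
    then obtain \<nu> where "\<nu> \<in> B" "nonresonant \<nu>"
      using negligible_subset[OF negligible_resonant] by blast
    then show ?thesis
      by (auto simp: V_def I_def nonresonant_def)
  qed
  moreover have "nonresonant \<nu>" if "\<nu> \<in> B \<inter> (\<Inter>x\<in>I. V x)" for \<nu>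
    unfolding nonresonant_def
  proof (intro allI impI)
    fix p and \<alpha> \<kappa> :: "'r \<Rightarrow> nat"
    assume *: "mdeg \<kappa> \<le> 2" "\<alpha> \<noteq> \<kappa>"
    show "(\<Sum>j\<in>UNIV. \<nu> $ j $ p * of_nat (\<alpha> j)) \<noteq> (\<Sum>j\<in>UNIV. \<nu> $ j $ p * of_nat (\<kappa> j))"
    proof (cases "mdeg \<alpha> \<le> 2")
      case True
      then show ?thesis
        using that * by (auto simp: V_def I_def)
    next
      case False
      then show ?thesis
        using that * by (intro nonresonant_near_one) (auto simp: B_def)
    qed
  qed
  ultimately show ?thesis
    by blast
qed

theorem theorem5:
  "- (R_hat :: (complex ^ 'r::finite ^ 'r) set) \<in> null_sets lebesgue \<and>
   (\<exists>U :: (complex ^ 'r ^ 'r) set. open U \<and> U \<noteq> {} \<and> U \<subseteq> R_hat)"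
proof
  have "negligible (- R_hat :: (complex ^ 'r ^ 'r) set)"
    by (rule negligible_subset[OF negligible_resonant]) (use nonresonant_imp_R_hat in auto)
  then show "- (R_hat :: (complex ^ 'r ^ 'r) set) \<in> null_sets lebesgue"
    by (simp add: negligible_iff_null_sets)
  show "\<exists>U :: (complex ^ 'r ^ 'r) set. open U \<and> U \<noteq> {} \<and> U \<subseteq> R_hat"
    using open_nonresonant_subset nonresonant_imp_R_hat by blast
qed

end
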